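(* Suppose that there is a function $r\colon \mathbb{Z}_{\ge 1}\to\mathbb{Z}_{\ge 1}$ with $\log r(N)/\log N\to 0$ as $N\to\infty$ (i.e. $r(N)=N^{o(1)}$) such that for every $N$ there is a coloring of $[N]=\{1,\dots,N\}$ with $r(N)$ colors that contains no symmetrically colored 4-AP. Then for every $C>0$ one has $\rho_4(\alpha)<\alpha^C$ for all sufficiently small $\alpha>0$.
   Context: A 4-AP $n,n+d,n+2d,n+3d$ (all terms in $[N]$) with $d\neq 0$ is symmetrically colored if $n$ and $n+3d$ have the same color and $n+d$ and $n+2d$ have the same color. For $f\colon\mathbb{Z}/N\mathbb{Z}\to\mathbb{C}$, $\widehat f(r)=\mathbb{E}_{n\in\mathbb{Z}/N\mathbb{Z}}f(n)e^{-2\pi i rn/N}$; a set $A\subset\mathbb{Z}/N\mathbb{Z}$ is $\eta$-Fourier uniform if $|\widehat{1_A}(r)|\le\eta$ for all $r\ne0$. Define $\Lambda_4(f)=\mathbb{E}_{n,d\in\mathbb{Z}/N\mathbb{Z}}f(n)f(n+d)f(n+2d)f(n+3d)$. For $0<\alpha<1$, $\rho_4(\alpha)$ is the largest real number such that for every $\epsilon>0$ there exist $\eta>0$ and $N_0$ such that every $\eta$-Fourier uniform $A\subset\mathbb{Z}/N\mathbb{Z}$ with $N\ge N_0$ and $|A|\ge(\alpha-\epsilon)N$ satisfies $\Lambda_4(1_A)\ge\rho_4(\alpha)-\epsilon$. *)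

theory Defs
  imports Complex_Main "HOL-Library.FuncSet" "HOL-Library.Indicator_Function"
begin

text \<open>Colourings of \<open>[N]\<close> are functions on \<open>int\<close>, since the common difference of a
  progression may be negative.\<close>

definition symmetric_4AP :: "nat \<Rightarrow> (int \<Rightarrow> nat) \<Rightarrow> int \<Rightarrow> int \<Rightarrow> bool" where
  "symmetric_4AP N c n d \<longleftrightarrow>
     d \<noteq> 0 \<and> {n, n + d, n + 2 * d, n + 3 * d} \<subseteq> {1..int N} \<and>
     c n = c (n + 3 * d) \<and> c (n + d) = c (n + 2 * d)"

text \<open>The group \<open>\<int>/N\<int>\<close> is represented by the residues \<open>{..<N}\<close>: a function on it is a function
  on \<open>nat\<close> of which only the values on \<open>{..<N}\<close> are used, and the addition is taken modulo \<open>N\<close>.\<close>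

definition fourier :: "nat \<Rightarrow> (nat \<Rightarrow> complex) \<Rightarrow> nat \<Rightarrow> complex" where
  "fourier N f r =
     (\<Sum>n<N. f n * exp (- 2 * of_real pi * \<i> * of_nat r * of_nat n / of_nat N)) / of_nat N"

definition fourier_uniform :: "nat \<Rightarrow> real \<Rightarrow> nat set \<Rightarrow> bool" where
  "fourier_uniform N \<eta> A \<longleftrightarrow> (\<forall>r\<in>{1..<N}. norm (fourier N (indicator A) r) \<le> \<eta>)"

definition Lambda4 :: "nat \<Rightarrow> (nat \<Rightarrow> 'a :: real_normed_field) \<Rightarrow> 'a" where
  "Lambda4 N f =
     (\<Sum>n<N. \<Sum>d<N. f n * f ((n + d) mod N) * f ((n + 2 * d) mod N) * f ((n + 3 * d) mod N))
       / of_nat N ^ 2"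

definition rho4_admissible :: "real \<Rightarrow> real \<Rightarrow> bool" where
  "rho4_admissible \<alpha> \<rho> \<longleftrightarrow>
     (\<forall>\<epsilon>>0. \<exists>\<eta>>0. \<exists>N0>0. \<forall>N\<ge>N0. \<forall>A\<subseteq>{..<N}.
        fourier_uniform N \<eta> A \<longrightarrow> real (card A) \<ge> (\<alpha> - \<epsilon>) * real N \<longrightarrow>
        Lambda4 N (indicator A) \<ge> \<rho> - \<epsilon>)"

text \<open>The largest admissible number is rendered as a supremum. For \<open>0 < \<alpha> < 1\<close> the two lemmas below
  show that this is the supremum of a nonempty set that is bounded above, so it agrees with the
  maximum whenever the latter exists.\<close>

definition rho4 :: "real \<Rightarrow> real" where
  "rho4 \<alpha> = Sup {\<rho>. rho4_admissible \<alpha> \<rho>}"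

lemma rho4_admissible_0: "rho4_admissible \<alpha> 0"
proof -
  have "Lambda4 N (indicator A) \<ge> (0 :: real)" for N A
    by (auto simp: Lambda4_def intro!: divide_nonneg_nonneg sum_nonneg)
  then have "Lambda4 N (indicator A) \<ge> 0 - \<epsilon>" if "\<epsilon> > 0" for N A and \<epsilon> :: real
    using that by (smt (verit))
  then show ?thesis
    unfolding rho4_admissible_def by (meson zero_less_one)
qed

lemma rho4_admissible_le_1:
  assumes "\<alpha> < 1" "rho4_admissible \<alpha> \<rho>"
  shows "\<rho> \<le> 1"
proof -
  obtain \<eta> N0 where "\<eta> > 0" "N0 > 0" and *: "\<And>N A. N \<ge> N0 \<Longrightarrow> A \<subseteq> {..<N} \<Longrightarrow>
      fourier_uniform N \<eta> A \<Longrightarrow> real (card A) \<ge> (\<alpha> - 1) * real N \<Longrightarrow>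
      Lambda4 N (indicator A) \<ge> \<rho> - 1"
    using assms(2) unfolding rho4_admissible_def by (meson zero_less_one)
  have "fourier_uniform N0 \<eta> {}"
    using \<open>\<eta> > 0\<close> by (simp add: fourier_uniform_def fourier_def)
  moreover have "real (card ({} :: nat set)) \<ge> (\<alpha> - 1) * real N0"
    using assms(1) by (simp add: mult_nonpos_nonneg)
  ultimately have "Lambda4 N0 (indicator {}) \<ge> \<rho> - 1"
    using *[of N0 "{}"] by simp
  then show ?thesis by (simp add: Lambda4_def)
qed

end

(*
The counterexample sets live in Z/N with N = M p^2, where M = 4L is fixed and p is a large prime. A
colouring of [L] without symmetric 4-APs is copied, with fresh colours, onto the four blocks of Z/M,
which gives a colouring of Z/M by 4 r(L) colours. The set A consists of those n for which the
quadratic phase n^2 mod p^2 lies in an interval depending on the colour of n mod M. All these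
intervals have the same density, about alpha, and are placed at points u_i such that u_i + 3 u_j
determines (i, j). As n^2 - 3(n+d)^2 + 3(n+2d)^2 - (n+3d)^2 = 0, every 4-AP in A is symmetrically
coloured modulo M, so that M divides d and Lambda_4(A) is at most 1/M. The points u_i have size
polynomial in r(L) = L^{o(1)}, so L can be taken to be a large power of 1/alpha.
*)

theory Submission
  imports
    Defs
    "HOL-Analysis.Convex"
    "HOL-Library.Real_Mod"
    "HOL-Real_Asymp.Real_Asymp"
    "HOL-Number_Theory.Cong"
begin

subsection \<open>Colourings of cyclic groups\<close>

text \<open>The binary digits of \<open>n\<close>, read in base 5: the digits of \<open>spread a + 3 * spread b\<close> then lie in
  \<open>{0, 1, 3, 4}\<close>, without carries, and each of them determines the digits of \<open>a\<close> and \<open>b\<close>.\<close>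

fun spread :: "nat \<Rightarrow> nat" where
  "spread n = (if n = 0 then 0 else n mod 2 + 5 * spread (n div 2))"

declare spread.simps [simp del]

lemma spread_rec: "spread n = n mod 2 + 5 * spread (n div 2)"
  by (cases "n = 0") (simp_all add: spread.simps[of n] spread.simps[of 0])

text \<open>Halving \<open>n\<close> divides its cube by 8, which outweighs the factor 5 in
  \<open>spread\<close>. A polynomial bound keeps the interval positions polynomial in the number of
  colours.\<close>

lemma spread_le: "spread n \<le> n ^ 3"
proof (induction n rule: less_induct)
  case (less n)
  show ?case
  proof (cases "n = 0")
    case False
    define q e where "q = n div 2" and "e = n mod 2"
    have n: "n = 2 * q + e" and e: "e = 0 \<or> e = 1" by (auto simp: q_def e_def)
    have "spread n = e + 5 * spread q" unfolding q_def e_def by (rule spread_rec)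
    also have "\<dots> \<le> e + 5 * q ^ 3"
      using less.IH[of q] False by (simp add: q_def)
    also have "\<dots> \<le> n ^ 3"
      using e unfolding n by (auto simp: power3_eq_cube algebra_simps)
    finally show ?thesis .
  qed (simp add: spread.simps)
qed

lemma spread_add_eq:
  assumes "spread a + 3 * spread b = spread c + 3 * spread d"
  shows "a = c \<and> b = d"
  using assms
proof (induction "a + b + c + d" arbitrary: a b c d rule: less_induct)
  case less
  show ?case
  proof (cases "a + b + c + d = 0")
    case False
    have eq: "(a mod 2 + 3 * (b mod 2)) + 5 * (spread (a div 2) + 3 * spread (b div 2)) =
              (c mod 2 + 3 * (d mod 2)) + 5 * (spread (c div 2) + 3 * spread (d div 2))"
      using less.prems unfolding spread_rec[of a] spread_rec[of b] spread_rec[of c] spread_rec[of d]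
      by (simp add: algebra_simps)
    have bits: "x mod 2 = 0 \<or> x mod 2 = 1" for x :: nat by auto
    have low_eq: "s = t" if "s + 5 * u = t + 5 * v" "s < 5" "t < 5" for s t u v :: nat
      using that by presburger
    have "a mod 2 + 3 * (b mod 2) = c mod 2 + 3 * (d mod 2)"
      using eq by (rule low_eq) (use bits[of a] bits[of b] bits[of c] bits[of d] in linarith)+
    hence low: "a mod 2 = c mod 2 \<and> b mod 2 = d mod 2"
      using bits[of a] bits[of b] bits[of c] bits[of d] by auto
    have "a div 2 + b div 2 + c div 2 + d div 2 < a + b + c + d"
      using False by linarith
    moreover have "spread (a div 2) + 3 * spread (b div 2) = spread (c div 2) + 3 * spread (d div 2)"
      using eq low by simp
    ultimately have "a div 2 = c div 2 \<and> b div 2 = d div 2"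
      by (rule less.hyps)
    with low show ?thesis by (metis div_mult_mod_eq)
  qed simp
qed

text \<open>Each of the four blocks of length \<open>L\<close> has its own palette, so residues of
  equal colour differ by less than \<open>L\<close>. A symmetric progression then lifts to the
  integers inside a single block, a copy of the coloured interval, where only difference 0 is
  possible.\<close>

lemma cyclic_coloring:
  assumes L: "L \<ge> 1" and R: "R \<ge> 1"
    and c: "c \<in> {1..int L} \<rightarrow> {1..R}" and nosym: "\<nexists>n d. symmetric_4AP L c n d"
  obtains g :: "nat \<Rightarrow> nat" where "\<And>m. m < 4 * L \<Longrightarrow> g m < 4 * R"
    and "\<And>n d. g (n mod (4 * L)) = g ((n + 3 * d) mod (4 * L)) \<Longrightarrow>
           g ((n + d) mod (4 * L)) = g ((n + 2 * d) mod (4 * L)) \<Longrightarrow> 4 * L dvd d"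
proof
  \<comment> \<open>The shift by 1 is needed because \<open>c\<close> is indexed from 1 and residues
    from 0. The colour \<open>g\<close> stores the block and \<open>b m - 1 < R\<close> as quotient
    and remainder by \<open>R\<close>.\<close>
  define b where "b m = c (int (m mod L) + 1)" for m
  define g where "g m = (m div L) * R + (b m - 1)" for m
  have b: "b m \<in> {1..R}" for m
  proof -
    have "m mod L < L" using L by simp
    hence "int (m mod L) + 1 \<in> {1..int L}" by simp
    thus ?thesis using c unfolding b_def by blast
  qed
  have g_eq: "m div L = k div L \<and> b m = b k" if "g m = g k" for m k
  proof -
    have bm: "b m - 1 < R" "b k - 1 < R" "b m \<ge> 1" "b k \<ge> 1" using b[of m] b[of k] R by auto
    have "(q * R + x) div R = q \<and> (q * R + x) mod R = x" if "x < R" for q x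
      using that by simp
    hence "m div L = k div L \<and> b m - 1 = b k - 1"
      using bm that unfolding g_def by metis
    with bm show ?thesis by auto
  qed
  show "g m < 4 * R" if "m < 4 * L" for m
  proof -
    have "m div L < 4" using that L by (simp add: div_less_iff_less_mult)
    hence "Suc (m div L) * R \<le> 4 * R" by (intro mult_right_mono) auto
    moreover have "b m - 1 < R" using b[of m] R by auto
    ultimately show ?thesis unfolding g_def mult_Suc by linarith
  qed
  fix n d :: nat
  define y where "y i = (n + i * d) mod (4 * L)" for i
  assume "g (n mod (4 * L)) = g ((n + 3 * d) mod (4 * L))"
    and "g ((n + d) mod (4 * L)) = g ((n + 2 * d) mod (4 * L))"
  hence y03: "y 0 div L = y 3 div L" "b (y 0) = b (y 3)" and y12: "y 1 div L = y 2 div L" "b (y 1) = b (y 2)"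
    using g_eq[of "y 0" "y 3"] g_eq[of "y 1" "y 2"] unfolding y_def by auto
  have y_lt: "y i < 4 * L" for i using L by (simp add: y_def)
  have y_cong: "[int (y i) = int n + int i * int d] (mod 4 * int L)" for i
    unfolding y_def cong_def by (simp add: zmod_int)
  txt \<open>Both \<open>y 2 - y 1\<close> and \<open>y 3 - y 0\<close> are less than \<open>L\<close> in absolute value, and \<open>4 * L\<close> is large enough
    for the latter to equal three times the former in the integers: the progression does not wrap.\<close>
  define e where "e = int (y 2) - int (y 1)"
  have split: "int (y i) = int L * int (y i div L) + int (y i mod L)" for i
    by (metis mult_div_mod_eq of_nat_add of_nat_mult)
  have rem: "int (y i mod L) < int L" "0 \<le> int (y i mod L)" for i using L by simp_all
  have e_small: "\<bar>e\<bar> < int L"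
    using split[of 1] split[of 2] rem[of 1] rem[of 2] unfolding e_def y12(1) by linarith
  have f_small: "\<bar>int (y 3) - int (y 0)\<bar> < int L"
    using split[of 3] split[of 0] rem[of 3] rem[of 0] unfolding y03(1) by linarith
  have small0: "x = 0" if "4 * int L dvd x" "\<bar>x\<bar> < 4 * int L" for x
    using that dvd_imp_le_int by force
  have e_cong: "[e = int d] (mod 4 * int L)"
    using cong_diff[OF y_cong[of 2] y_cong[of 1]] unfolding e_def by simp
  have "[int (y 3) - int (y 0) = 3 * int d] (mod 4 * int L)"
    using cong_diff[OF y_cong[of 3] y_cong[of 0]] by simp
  moreover have "[3 * e = 3 * int d] (mod 4 * int L)"
    using e_cong by (rule cong_scalar_left)
  ultimately have "4 * int L dvd (int (y 3) - int (y 0) - 3 * e)"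
    by (meson cong_iff_dvd_diff cong_sym cong_trans)
  hence y3: "int (y 3) = int (y 0) + 3 * e"
    using small0[of "int (y 3) - int (y 0) - 3 * e"] e_small f_small by linarith
  have "[int (y 1) - int (y 0) = int d] (mod 4 * int L)"
    using cong_diff[OF y_cong[of 1] y_cong[of 0]] by simp
  hence "4 * int L dvd (int (y 1) - int (y 0) - e)"
    using e_cong by (meson cong_iff_dvd_diff cong_sym cong_trans)
  \<comment> \<open>\<open>y 0 + e\<close> lies between \<open>y 0\<close> and
    \<open>y 3 = y 0 + 3 * e\<close>, so it is in the same range below \<open>4 * L\<close> as
    \<open>y 1\<close>.\<close>
  moreover have "\<bar>int (y 1) - int (y 0) - e\<bar> < 4 * int L"
    using y_lt[of 0] y_lt[of 1] y_lt[of 3] y3 by linarith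
  ultimately have y1: "int (y 1) = int (y 0) + e"
    using small0 by fastforce
  have y2: "int (y 2) = int (y 0) + 2 * e" using y1 unfolding e_def by simp
  have q: "y 1 div L = y 0 div L"
  proof -
    have "y 0 \<le> y 1 \<and> y 1 \<le> y 3 \<or> y 3 \<le> y 1 \<and> y 1 \<le> y 0" using y1 y3 by linarith
    thus ?thesis using y03 by (metis div_le_mono le_antisym)
  qed
  have "e = 0"
  proof (rule ccontr)
    assume "e \<noteq> 0"
    define z where "z = int (y 0 mod L) + 1"
    have z: "int (y 1 mod L) + 1 = z + e" "int (y 2 mod L) + 1 = z + 2 * e" "int (y 3 mod L) + 1 = z + 3 * e"
      using split[of 0] split[of 1] split[of 2] split[of 3] y1 y2 y3
      unfolding z_def y12(1)[symmetric] y03(1)[symmetric] q by linarith+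
    have "c z = c (z + 3 * e)" "c (z + e) = c (z + 2 * e)"
      using y03(2) y12(2) unfolding b_def z by (simp_all add: z_def)
    moreover have "{z, z + e, z + 2 * e, z + 3 * e} \<subseteq> {1..int L}"
    proof -
      have "z \<in> {1..int L}" "z + e \<in> {1..int L}" "z + 2 * e \<in> {1..int L}" "z + 3 * e \<in> {1..int L}"
        using rem[of 0] rem[of 1] rem[of 2] rem[of 3] z z_def
        unfolding atLeastAtMost_iff by (intro conjI; linarith)+
      thus ?thesis by blast
    qed
    ultimately have "symmetric_4AP L c z e"
      using \<open>e \<noteq> 0\<close> unfolding symmetric_4AP_def by blast
    thus False using nosym by blast
  qed
  thus "4 * L dvd d"
    using e_cong by (metis cong_0_iff cong_sym of_nat_dvd_iff of_nat_mult of_nat_numeral)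
qed

subsection \<open>Sums of roots of unity\<close>

definition unity_root :: "nat \<Rightarrow> int \<Rightarrow> complex" where
  "unity_root k x = cis (2 * pi * of_int x / of_nat k)"

lemma norm_unity_root [simp]: "norm (unity_root k x) = 1"
  by (simp add: unity_root_def)

lemma unity_root_0 [simp]: "unity_root k 0 = 1"
  by (simp add: unity_root_def)

lemma unity_root_add: "unity_root k (x + y) = unity_root k x * unity_root k y"
  by (simp add: unity_root_def cis_mult add_divide_distrib ring_distribs)

lemma unity_root_power: "unity_root k (x * int n) = unity_root k x ^ n"
  by (induction n) (simp_all add: unity_root_add ring_distribs)

lemma cnj_unity_root: "cnj (unity_root k x) = unity_root k (- x)"
  by (simp add: unity_root_def cis_cnj)

lemma unity_root_eq_1_iff:
  assumes "k > 0"
  shows "unity_root k x = 1 \<longleftrightarrow> int k dvd x"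
proof -
  have "2 * pi * real_of_int x / real k = real_of_int n * (2 * pi) \<longleftrightarrow> x = int k * n" for n
  proof -
    have "2 * pi * real_of_int x / real k = real_of_int n * (2 * pi) \<longleftrightarrow>
          real_of_int x = real k * real_of_int n"
      using assms by (simp add: field_simps)
    also have "\<dots> \<longleftrightarrow> x = int k * n"
      by (metis of_int_eq_iff of_int_mult of_int_of_nat_eq)
    finally show ?thesis .
  qed
  thus ?thesis by (simp add: unity_root_def cis_eq_1_iff dvd_def)
qed

lemma unity_root_cong:
  assumes "k > 0" "[x = y] (mod int k)"
  shows "unity_root k x = unity_root k y"
proof -
  have "unity_root k (x - y) = 1"
    using assms by (simp add: unity_root_eq_1_iff cong_iff_dvd_diff)
  thus ?thesis using unity_root_add[of k "x - y" y] by simp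
qed

lemma sum_unity_root:
  assumes "k > 0"
  shows "(\<Sum>n<k. unity_root k (x * int n)) = (if int k dvd x then of_nat k else 0)"
proof -
  have "unity_root k x ^ k = 1"
    using assms by (simp add: unity_root_eq_1_iff flip: unity_root_power)
  thus ?thesis
    using assms by (simp add: unity_root_power geometric_sum unity_root_eq_1_iff)
      (auto simp: sum_gp_strict unity_root_eq_1_iff)
qed

text \<open>The splitting \<open>n = a + q * b\<close> serves three purposes:
  \<open>q = M * p\<close> gives the fibres, \<open>q = p\<close> groups them by \<open>a\<close>
  modulo \<open>p\<close>, and \<open>q = M\<close> sorts differences by their residue modulo
  \<open>M\<close>.\<close>

lemma sum_lessThan_mult:
  fixes f :: "nat \<Rightarrow> 'a :: comm_monoid_add"
  shows "(\<Sum>n<q * p. f n) = (\<Sum>a<q. \<Sum>b<p. f (a + q * b))"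
proof -
  have "(\<Sum>n<q * p. f n) = (\<Sum>b<p. \<Sum>n\<in>{b * q..<b * q + q}. f n)"
    by (simp add: sum.nat_group mult.commute)
  also have "\<dots> = (\<Sum>b<p. \<Sum>a<q. f (a + q * b))"
    using sum.shift_bounds_nat_ivl[of f 0 "_ * q" q]
    by (simp add: add.commute mult.commute atLeast0LessThan)
  also have "\<dots> = (\<Sum>a<q. \<Sum>b<p. f (a + q * b))"
    by (rule sum.swap)
  finally show ?thesis .
qed

text \<open>Parseval and Cauchy-Schwarz.\<close>

lemma sum_norm_interval_le:
  assumes k: "k > 0" and v: "v \<le> k"
  shows "(\<Sum>j<k. norm (\<Sum>t<v. unity_root k (int j * int t))) \<le> real k * sqrt (real k)"
proof -
  define H where "H j = (\<Sum>t<v. unity_root k (int j * int t))" for j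
  have "of_real (\<Sum>j<k. (norm (H j))\<^sup>2) =
        (\<Sum>j<k. \<Sum>t<v. \<Sum>t'<v. unity_root k ((int t - int t') * int j))"
    unfolding H_def of_real_sum complex_norm_square cnj_sum sum_product
    by (intro sum.cong refl)
       (simp add: cnj_unity_root unity_root_add[symmetric] algebra_simps)
  also have "\<dots> = (\<Sum>t<v. \<Sum>j<k. \<Sum>t'<v. unity_root k ((int t - int t') * int j))"
    by (rule sum.swap)
  also have "\<dots> = (\<Sum>t<v. \<Sum>t'<v. \<Sum>j<k. unity_root k ((int t - int t') * int j))"
    by (intro sum.cong refl sum.swap)
  also have "\<dots> = (\<Sum>t<v. \<Sum>t'<v. if t = t' then of_nat k else 0)"
  proof (intro sum.cong refl)
    fix t t' assume "t \<in> {..<v}" "t' \<in> {..<v}"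
    hence "\<bar>int t - int t'\<bar> < int k" using v by auto
    hence "int k dvd int t - int t' \<longleftrightarrow> t = t'"
      using dvd_imp_le_int[of "int t - int t'" "int k"] by force
    thus "(\<Sum>j<k. unity_root k ((int t - int t') * int j)) = (if t = t' then of_nat k else 0)"
      using k by (simp add: sum_unity_root)
  qed
  also have "\<dots> = of_real (real v * real k)" by simp
  finally have "(\<Sum>j<k. (norm (H j))\<^sup>2) = real v * real k"
    by (simp only: of_real_eq_iff)
  moreover have "(\<Sum>j<k. norm (H j))\<^sup>2 \<le> real k * (\<Sum>j<k. (norm (H j))\<^sup>2)"
    using sum_squared_le_sum_of_squares[of "\<lambda>j. norm (H j)" "{..<k}"] by (simp add: mult.commute)
  ultimately have "(\<Sum>j<k. norm (H j))\<^sup>2 \<le> real k * (real k * real k)"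
    using v by (simp add: mult_left_mono mult_right_mono order_trans)
  also have "\<dots> = (real k * sqrt (real k))\<^sup>2"
    by (simp add: power_mult_distrib power2_eq_square)
  finally show ?thesis
    unfolding H_def by (rule power2_le_imp_le) simp
qed

subsection \<open>Quadratic sets\<close>

text \<open>The interval is given in units of \<open>p\<close>: \<open>(n\<^sup>2 div p) mod p\<close> is the leading base-\<open>p\<close> digit of
  \<open>n\<^sup>2 mod p\<^sup>2\<close>. Along a fibre \<open>a + M p b\<close> with \<open>b < p\<close> the residue modulo \<open>M\<close> is constant and this
  digit is affine in \<open>b\<close>, which makes exponential sums over the set elementary.\<close>

definition quad_set :: "nat \<Rightarrow> nat \<Rightarrow> nat \<Rightarrow> (nat \<Rightarrow> nat) \<Rightarrow> nat set" where
  "quad_set M p v l =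
     {n. n < M * p * p \<and> (n\<^sup>2 div p) mod p \<in> {l (n mod M)..<l (n mod M) + v}}"

lemma bij_betw_affine_mod:
  fixes e g p :: nat
  assumes "p > 0" "coprime g p"
  shows "bij_betw (\<lambda>b. (e + g * b) mod p) {..<p} {..<p}"
proof -
  have "inj_on (\<lambda>b. (e + g * b) mod p) {..<p}"
  proof (rule inj_onI)
    fix x y assume xy: "x \<in> {..<p}" "y \<in> {..<p}" and "(e + g * x) mod p = (e + g * y) mod p"
    hence "[g * x = g * y] (mod p)" by (simp add: cong_def[symmetric] cong_add_lcancel_nat)
    hence "[x = y] (mod p)" using assms by (simp add: cong_mult_lcancel_nat)
    thus "x = y" using xy by (simp add: cong_def)
  qed
  thus ?thesis using assms(1) by (simp add: bij_betw_def endo_inj_surj image_subset_iff)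
qed

text \<open>Invertibility of \<open>g\<close> makes \<open>e + g * b\<close> run once through all
  residues, and \<open>l + v \<le> p\<close> keeps the interval from wrapping.\<close>

lemma sum_affine_mod_interval:
  fixes F :: "nat \<Rightarrow> 'a :: semiring_1" and e g p :: nat
  assumes "p > 0" "coprime g p" "l + v \<le> p"
  shows "(\<Sum>b<p. of_bool ((e + g * b) mod p \<in> {l..<l + v}) * F ((e + g * b) mod p)) =
         (\<Sum>t<v. F (l + t))"
proof -
  have "(\<Sum>b<p. of_bool ((e + g * b) mod p \<in> {l..<l + v}) * F ((e + g * b) mod p)) =
        (\<Sum>t<p. of_bool (t \<in> {l..<l + v}) * F t)"
    using sum.reindex_bij_betw[OF bij_betw_affine_mod[OF assms(1,2), of e],
        of "\<lambda>t. of_bool (t \<in> {l..<l + v}) * F t"] by simp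
  also have "\<dots> = (\<Sum>t\<in>{l..<l + v}. F t)"
    using assms(3) by (intro sum.mono_neutral_cong_right) auto
  also have "\<dots> = (\<Sum>t<v. F (l + t))"
    using sum.shift_bounds_nat_ivl[of F 0 l v] by (simp add: add.commute atLeast0LessThan)
  finally show ?thesis .
qed

text \<open>In the variable \<open>t = e + g * b\<close> the frequency \<open>x\<close> becomes
  \<open>j = x / g\<close> modulo \<open>p\<close>, while \<open>e\<close> and \<open>l\<close>
  contribute only factors of modulus 1. So the norm does not see where the interval lies.\<close>

lemma norm_sum_affine_mod_interval:
  fixes e g p :: nat and j x :: int
  assumes "p > 0" "coprime g p" "l + v \<le> p" and j: "[j * int g = x] (mod int p)"
  shows "norm (\<Sum>b<p. of_bool ((e + g * b) mod p \<in> {l..<l + v}) * unity_root p (x * int b)) =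
         norm (\<Sum>t<v. unity_root p (j * int t))"
proof -
  have root: "unity_root p (x * int b) = unity_root p (- j * int e) * unity_root p (j * int ((e + g * b) mod p))" for b
  proof -
    have "[- j * int e + j * int ((e + g * b) mod p) = - j * int e + j * int (e + g * b)] (mod int p)"
      by (intro cong_add cong_refl cong_scalar_left) (simp add: zmod_int)
    also have "- j * int e + j * int (e + g * b) = (j * int g) * int b"
      by (simp add: algebra_simps)
    also have "[\<dots> = x * int b] (mod int p)"
      using j by (rule cong_scalar_right)
    finally have "unity_root p (x * int b) = unity_root p (- j * int e + j * int ((e + g * b) mod p))"
      using unity_root_cong[OF assms(1)] by metis
    thus ?thesis by (simp only: unity_root_add)
  qed
  have "(\<Sum>b<p. of_bool ((e + g * b) mod p \<in> {l..<l + v}) * unity_root p (x * int b)) =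
        unity_root p (- j * int e) *
        (\<Sum>b<p. of_bool ((e + g * b) mod p \<in> {l..<l + v}) * unity_root p (j * int ((e + g * b) mod p)))"
    unfolding root sum_distrib_left by (intro sum.cong refl) (simp add: mult_ac)
  also have "\<dots> = unity_root p (- j * int e) * (\<Sum>t<v. unity_root p (j * int (l + t)))"
    by (subst sum_affine_mod_interval[OF assms(1-3), of e "\<lambda>t. unity_root p (j * int t)"]) simp
  also have "(\<Sum>t<v. unity_root p (j * int (l + t))) =
             unity_root p (j * int l) * (\<Sum>t<v. unity_root p (j * int t))"
    by (simp add: sum_distrib_left unity_root_add ring_distribs)
  finally show ?thesis by (simp add: norm_mult)
qed

text \<open>The cross term of the square loses one factor \<open>p\<close> in the division and
  becomes the linear term; the last square is divisible by \<open>p * p\<close> and vanishes from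
  the digit.\<close>

lemma quad_fibre:
  fixes a b M p :: nat
  assumes "p > 0"
  shows "((a + M * p * b)\<^sup>2 div p) mod p = (a\<^sup>2 div p + (2 * a * M) * b) mod p"
proof -
  have "(a + M * p * b)\<^sup>2 = a\<^sup>2 + p * (2 * a * M * b + p * (M * b)\<^sup>2)"
    by (simp add: power2_eq_square algebra_simps)
  hence "(a + M * p * b)\<^sup>2 div p = a\<^sup>2 div p + 2 * a * M * b + p * (M * b)\<^sup>2"
    using assms by simp
  thus ?thesis by simp
qed

lemma indicator_quad_set:
  assumes "a < M * p" "b < p"
  shows "indicator (quad_set M p v l) (a + M * p * b) =
         of_bool ((a\<^sup>2 div p + (2 * a * M) * b) mod p \<in> {l (a mod M)..<l (a mod M) + v})"
proof -
  have "a + M * p * b < M * p * Suc b" using assms by simp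
  also have "\<dots> \<le> M * p * p" using assms by (intro mult_left_mono) auto
  finally have "a + M * p * b < M * p * p" .
  moreover have "(a + M * p * b) mod M = a mod M"
    by (metis mod_mult_self2 mult.assoc)
  ultimately show ?thesis
    using assms quad_fibre[of p a M b] by (auto simp: quad_set_def indicator_def)
qed

lemma sum_quad_set:
  fixes f :: "nat \<Rightarrow> 'a :: semiring_1"
  shows "(\<Sum>n<M * p * p. indicator (quad_set M p v l) n * f n) =
    (\<Sum>a<M * p. \<Sum>b<p. of_bool ((a\<^sup>2 div p + (2 * a * M) * b) mod p \<in> {l (a mod M)..<l (a mod M) + v})
       * f (a + M * p * b))"
  unfolding sum_lessThan_mult[of _ "M * p" p] by (intro sum.cong refl) (simp add: indicator_quad_set)

lemma coprime_fibre:
  fixes a M p :: nat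
  assumes "prime p" "coprime (2 * M) p" "\<not> p dvd a"
  shows "coprime (2 * a * M) p"
  using assms prime_imp_coprime[of p a] by (simp add: coprime_commute)

text \<open>Of the \<open>M * p\<close> fibres, \<open>(p - 1) * M\<close> have \<open>a\<close> not
  divisible by \<open>p\<close>, and each of these meets the set in exactly \<open>v\<close> points;
  the others are dropped.\<close>

lemma card_quad_set:
  assumes p: "prime p" and M: "coprime (2 * M) p" and l: "\<And>m. l m + v \<le> p"
  shows "card (quad_set M p v l) \<ge> (p - 1) * M * v"
proof -
  define F where "F a = (\<Sum>b<p. of_bool ((a\<^sup>2 div p + (2 * a * M) * b) mod p
    \<in> {l (a mod M)..<l (a mod M) + v}) * (1 :: nat))" for a
  have p0: "p > 0" using p by (rule prime_gt_0_nat)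
  have F: "F a = v" if "\<not> p dvd a" for a
    unfolding F_def using sum_affine_mod_interval[OF p0 coprime_fibre[OF p M that] l[of "a mod M"],
      where e = "a\<^sup>2 div p" and F = "\<lambda>_. 1 :: nat"] by simp
  have sub: "quad_set M p v l \<subseteq> {..<M * p * p}" by (auto simp: quad_set_def)
  have "(p - 1) * M * v = (\<Sum>a\<in>{1..<p}. \<Sum>i<M. v)" by simp
  also have "\<dots> = (\<Sum>a\<in>{1..<p}. \<Sum>i<M. F (a + p * i))"
    by (intro sum.cong refl F[symmetric]) (auto simp: nat_dvd_not_less dvd_add_left_iff)
  also have "\<dots> \<le> (\<Sum>a<p. \<Sum>i<M. F (a + p * i))"
    by (intro sum_mono2) auto
  also have "\<dots> = (\<Sum>a<M * p. F a)"
    by (simp add: sum_lessThan_mult mult.commute[of M])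
  also have "\<dots> = (\<Sum>n<M * p * p. indicator (quad_set M p v l) n * 1)"
    unfolding sum_quad_set F_def ..
  also have "\<dots> = card (quad_set M p v l)"
    using sub by (simp add: sum.If_cases indicator_def Int_absorb1 flip: of_bool_def)
  finally show ?thesis .
qed

section \<open>Fourier uniformity of quadratic sets\<close>

lemma unity_root_scale:
  assumes "k > 0"
  shows "unity_root (k * m) (int k * x) = unity_root m x"
  using assms by (simp add: unity_root_def mult.assoc)

lemma fourier_indicator_eq:
  "fourier N (indicator A) s =
     (\<Sum>n<N. indicator A n * unity_root N (- int s * int n)) / of_nat N"
proof -
  have "exp (- 2 * of_real pi * \<i> * of_nat s * of_nat n / of_nat N) = unity_root N (- int s * int n)" for n
    unfolding unity_root_def cis_conv_exp by (rule arg_cong[of _ _ exp]) (simp add: mult_ac)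
  thus ?thesis by (simp add: fourier_def)
qed

text \<open>The \<open>M\<close> fibres with \<open>p\<close> dividing \<open>a\<close> have no
  invertible slope and receive the trivial bound \<open>B\<close>; the others are grouped by
  \<open>a\<close> modulo \<open>p\<close>, with \<open>M\<close> fibres in each class.\<close>

lemma sum_norm_fibres_le:
  fixes f :: "nat \<Rightarrow> real"
  assumes p: "p > 0" and bound: "\<And>a. f a \<le> B"
    and G: "\<And>a i. a \<in> {1..<p} \<Longrightarrow> f (a + p * i) \<le> G a"
  shows "(\<Sum>a<M * p. f a) \<le> real M * (B + (\<Sum>a\<in>{1..<p}. G a))"
proof -
  have "(\<Sum>a<M * p. f a) = (\<Sum>a<p. \<Sum>i<M. f (a + p * i))"
    by (simp add: sum_lessThan_mult mult.commute[of M])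
  also have "{..<p} = insert 0 {1..<p}" using p by auto
  also have "(\<Sum>a\<in>insert 0 {1..<p}. \<Sum>i<M. f (a + p * i)) =
             (\<Sum>i<M. f (p * i)) + (\<Sum>a\<in>{1..<p}. \<Sum>i<M. f (a + p * i))"
    by simp
  also have "\<dots> \<le> (\<Sum>i<M. B) + (\<Sum>a\<in>{1..<p}. \<Sum>i<M. G a)"
    by (intro add_mono sum_mono bound G)
  also have "\<dots> = real M * (B + (\<Sum>a\<in>{1..<p}. G a))"
    by (simp add: sum_distrib_left ring_distribs)
  finally show ?thesis .
qed

text \<open>The bound depends on neither \<open>M\<close>, \<open>v\<close> nor the interval
  positions, so any prescribed uniformity is reached once \<open>p\<close> is large.\<close>

lemma norm_fourier_quad_set_le:
  assumes p: "prime p" and M: "coprime (2 * M) p" "M > 0" and l: "\<And>m. l m + v \<le> p"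
    and s: "s \<in> {1..<M * p * p}"
  shows "norm (fourier (M * p * p) (indicator (quad_set M p v l)) s) \<le> 2 / sqrt (real p)"
proof -
  define N where "N = M * p * p"
  define J where "J a b = (of_bool ((a\<^sup>2 div p + (2 * a * M) * b) mod p
    \<in> {l (a mod M)..<l (a mod M) + v}) :: complex)" for a b
  define F where "F a = (\<Sum>b<p. J a b * unity_root p (- int s * int b))" for a
  define S where "S = (\<Sum>n<N. indicator (quad_set M p v l) n * unity_root N (- int s * int n))"
  have p0: "p > 0" using p by (rule prime_gt_0_nat)
  \<comment> \<open>On a fibre the phase splits into a constant and a character of \<open>b\<close>
    modulo \<open>p\<close>, because \<open>N = (M * p) * p\<close>.\<close>
  have root: "unity_root N (- int s * int (a + M * p * b)) =
      unity_root N (- int s * int a) * unity_root p (- int s * int b)" for a b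
  proof -
    have "unity_root N (int (M * p) * (- int s * int b)) = unity_root p (- int s * int b)"
      unfolding N_def using M p0 by (intro unity_root_scale) simp
    moreover have "- int s * int (a + M * p * b) = - int s * int a + int (M * p) * (- int s * int b)"
      by (simp add: algebra_simps)
    ultimately show ?thesis by (simp only: unity_root_add)
  qed
  have S: "S = (\<Sum>a<M * p. unity_root N (- int s * int a) * F a)"
    unfolding S_def N_def sum_quad_set unfolding N_def[symmetric] root F_def J_def sum_distrib_left
    by (intro sum.cong refl) (simp only: mult_ac)
  have F_le: "norm (F a) \<le> real p" for a
  proof -
    have "norm (F a) \<le> (\<Sum>b<p. norm (J a b * unity_root p (- int s * int b)))"
      unfolding F_def by (rule norm_sum)
    also have "\<dots> \<le> (\<Sum>b<p. 1)"
      by (intro sum_mono) (simp add: J_def norm_mult)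
    finally show ?thesis by simp
  qed
  have F: "norm (F a) = norm (\<Sum>t<v. unity_root p (j * int t))"
    if "\<not> p dvd a" "[j * int (2 * a * M) = - int s] (mod int p)" for a j
    unfolding F_def J_def
    by (rule norm_sum_affine_mod_interval[OF p0 coprime_fibre[OF p M(1) that(1)] l that(2)])
  have nd: "\<not> p dvd a + p * i" if "a \<in> {1..<p}" for a i
    using that by (auto simp: nat_dvd_not_less dvd_add_left_iff)
  have sqrt1: "1 \<le> sqrt (real p)" using p0 by simp
  have v: "v \<le> p" using l[of 0] by simp
  txt \<open>If \<open>p\<close> divides \<open>s\<close>, almost all fibre sums equal \<open>v\<close> and the sum over the fibres cancels.
    Otherwise the fibre sums run over the Fourier coefficients of an interval, each frequency
    \<open>j\<close> occurring at most \<open>M\<close> times.\<close>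
  have "norm S \<le> real M * (2 * (real p * sqrt (real p)))"
  proof (cases "p dvd s")
    case True
    then obtain s' where s': "s = p * s'" by blast
    have Fv: "F a = of_nat v" if "\<not> p dvd a" for a
    proof -
      have "unity_root p (- int s * int b) = 1" for b
        using p0 by (simp add: unity_root_eq_1_iff s')
      thus ?thesis unfolding F_def J_def
        using sum_affine_mod_interval[OF p0 coprime_fibre[OF p M(1) that] l[of "a mod M"],
          where e = "a\<^sup>2 div p" and F = "\<lambda>_. 1 :: complex"] by simp
    qed
    have "0 < s'" "s' < M * p" using s s' p0 by (auto simp: mult.commute)
    hence "\<not> M * p dvd s'" by (auto dest: nat_dvd_not_less)
    hence "\<not> int (M * p) dvd - int s'" by (simp only: dvd_minus_iff of_nat_dvd_iff not_False_eq_True)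
    hence "(\<Sum>a<M * p. unity_root (M * p) (- int s' * int a)) = 0"
      using M p0 by (subst sum_unity_root) auto
    moreover have "unity_root N (- int s * int a) = unity_root (M * p) (- int s' * int a)" for a
      using unity_root_scale[OF p0, of "M * p" "- int s' * int a"]
      by (simp add: N_def s' mult_ac)
    \<comment> \<open>As the full character sum over \<open>a\<close> vanishes, subtracting
      \<open>v\<close> from every \<open>F a\<close> is free and leaves only the fibres with
      \<open>p\<close> dividing \<open>a\<close>.\<close>
    ultimately have "S = (\<Sum>a<M * p. unity_root N (- int s * int a) * (F a - of_nat v))"
      by (simp add: S ring_distribs sum_subtractf flip: sum_distrib_right)
    also have "norm \<dots> \<le> (\<Sum>a<M * p. norm (F a - of_nat v))"
      by (rule sum_norm_le) (simp add: norm_mult)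
    also have "\<dots> \<le> real M * (2 * real p + (\<Sum>a\<in>{1..<p}. 0))"
    proof (rule sum_norm_fibres_le[OF p0])
      fix a show "norm (F a - of_nat v) \<le> 2 * real p"
        using norm_triangle_ineq4[of "F a" "of_nat v"] F_le[of a] v by simp
    qed (simp add: Fv nd)
    also have "\<dots> \<le> real M * (2 * (real p * sqrt (real p)))"
      using sqrt1 by (simp add: mult_left_mono)
    finally show ?thesis .
  next
    case False
    \<comment> \<open>\<open>j\<close> is the frequency \<open>- s\<close> divided by the slope
      \<open>2 * a * M\<close> of the fibre.\<close>
    have "\<exists>j<p. [int j * int (2 * a * M) = - int s] (mod int p)" if "a \<in> {1..<p}" for a
    proof -
      have "coprime (int (2 * a * M)) (int p)"
        using coprime_fibre[OF p M(1)] nd[OF that, of 0] by (simp only: coprime_int_iff) simp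
      then obtain y where y: "[int (2 * a * M) * y = 1] (mod int p)"
        by (rule cong_solve_coprime_int[THEN exE])
      define j where "j = nat ((y * - int s) mod int p)"
      have j: "int j = (y * - int s) mod int p" using p0 by (simp add: j_def)
      have "[int j * int (2 * a * M) = (y * - int s) * int (2 * a * M)] (mod int p)"
        unfolding j by (intro cong_scalar_right) simp
      also have "(y * - int s) * int (2 * a * M) = (int (2 * a * M) * y) * - int s"
        by (simp only: mult_ac)
      also have "[\<dots> = 1 * - int s] (mod int p)"
        using y by (rule cong_scalar_right)
      finally have "[int j * int (2 * a * M) = - int s] (mod int p)" by simp
      moreover have "int j < int p" unfolding j using p0 by simp
      ultimately show ?thesis by (metis of_nat_less_iff)
    qed
    then obtain j where j: "\<And>a. a \<in> {1..<p} \<Longrightarrow> j a < p"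
      "\<And>a. a \<in> {1..<p} \<Longrightarrow> [int (j a) * int (2 * a * M) = - int s] (mod int p)"
      by metis
    \<comment> \<open>Since \<open>p\<close> does not divide \<open>s\<close>, \<open>j a\<close> is
      invertible and determines \<open>a\<close>; the sum of \<open>H (j a)\<close> is then part of
      the full sum bounded by Parseval.\<close>
    have inj: "inj_on j {1..<p}"
    proof (rule inj_onI)
      fix x y assume xy: "x \<in> {1..<p}" "y \<in> {1..<p}" and eq: "j x = j y"
      have "[int (j x) * int (2 * x * M) = int (j x) * int (2 * y * M)] (mod int p)"
        using j(2)[OF xy(1)] j(2)[OF xy(2)] eq by (metis cong_sym cong_trans)
      moreover have "coprime (int (j x)) (int p)"
      proof -
        have "\<not> p dvd j x"
        proof
          assume "p dvd j x"
          hence "int p dvd int (j x) * int (2 * x * M)" by simp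
          hence "int p dvd - int s" using cong_dvd_iff[OF j(2)[OF xy(1)]] cong_dvd_modulus
            by (metis cong_0_iff cong_sym cong_trans j(2) xy(1))
          thus False using False by simp
        qed
        hence "coprime p (j x)" by (rule prime_imp_coprime[OF p])
        thus ?thesis by (simp add: coprime_commute)
      qed
      ultimately have "[int (2 * x * M) = int (2 * y * M)] (mod int p)"
        using cong_mult_lcancel by blast
      hence "[(2 * M) * x = (2 * M) * y] (mod p)"
        by (simp only: cong_int_iff) (simp only: mult_ac)
      hence "[x = y] (mod p)" using M(1) by (simp only: cong_mult_lcancel_nat)
      thus "x = y" using xy by (simp add: cong_def)
    qed
    define H where "H i = norm (\<Sum>t<v. unity_root p (int i * int t))" for i
    have "norm S \<le> (\<Sum>a<M * p. norm (F a))"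
      unfolding S by (rule sum_norm_le) (simp add: norm_mult)
    also have "\<dots> \<le> real M * (real p + (\<Sum>a\<in>{1..<p}. H (j a)))"
    proof (rule sum_norm_fibres_le[OF p0 F_le])
      fix a i assume a: "a \<in> {1..<p}"
      have "[int (j a) * int (2 * (a + p * i) * M) = int (j a) * int (2 * a * M)] (mod int p)"
        by (intro cong_scalar_left) (simp add: cong_iff_dvd_diff algebra_simps)
      also have "[int (j a) * int (2 * a * M) = - int s] (mod int p)"
        by (rule j(2)[OF a])
      finally show "norm (F (a + p * i)) \<le> H (j a)"
        using F[OF nd[OF a]] unfolding H_def by simp
    qed
    also have "(\<Sum>a\<in>{1..<p}. H (j a)) = (\<Sum>i\<in>j ` {1..<p}. H i)"
      using inj by (simp add: sum.reindex)
    also have "\<dots> \<le> (\<Sum>i<p. H i)"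
      using j(1) by (intro sum_mono2) (auto simp: H_def)
    also have "\<dots> \<le> real p * sqrt (real p)"
      unfolding H_def by (rule sum_norm_interval_le[OF p0 v])
    finally have "norm S \<le> real M * (real p + real p * sqrt (real p))"
      by (simp add: mult_left_mono)
    also have "\<dots> \<le> real M * (2 * (real p * sqrt (real p)))"
      using sqrt1 by (intro mult_left_mono) auto
    finally show ?thesis .
  qed
  hence "norm S / real N \<le> real M * (2 * (real p * sqrt (real p))) / real N"
    by (intro divide_right_mono) auto
  also have "\<dots> = 2 / sqrt (real p)"
    using M p0 by (simp add: N_def field_simps)
  finally show ?thesis
    by (simp only: fourier_indicator_eq norm_divide norm_of_nat S_def N_def)
qed

section \<open>Four-term progressions in quadratic sets\<close>

text \<open>The hypothesis on \<open>p\<close> keeps both sides of the quadratic identity below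
  \<open>p * p\<close>, so the congruence is an equality. Each reduced square exceeds its
  \<open>4 * v * p * w\<close> by less than \<open>v * p\<close>; with weights 1 and 3 the total
  excess stays below \<open>4 * v * p\<close>, and division by that number recovers the combination
  of the \<open>w\<close> values.\<close>

lemma quad_set_4AP:
  fixes n d p M v W :: nat and w :: "nat \<Rightarrow> nat"
  defines "N \<equiv> M * p * p" and "A \<equiv> quad_set M p v (\<lambda>m. 4 * v * w m)"
  assumes M: "M > 0" and w: "\<And>m. m < M \<Longrightarrow> w m \<le> W" and p: "4 * v * (4 * W + 1) \<le> p"
    and A: "n mod N \<in> A" "(n + d) mod N \<in> A" "(n + 2 * d) mod N \<in> A" "(n + 3 * d) mod N \<in> A"
  shows "w (n mod M) + 3 * w ((n + 2 * d) mod M) = w ((n + 3 * d) mod M) + 3 * w ((n + d) mod M)"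
proof -
  define x where "x k = k\<^sup>2 mod (p * p)" for k :: nat
  have "v > 0"
    using A(1) by (auto simp: A_def quad_set_def)
  hence "p > 0" using p by (cases "p = 0") auto
  have x: "x k div (4 * (v * p)) = w (k mod M) \<and> 4 * v * p * w (k mod M) \<le> x k \<and>
      x k < 4 * v * p * w (k mod M) + v * p" if "k mod N \<in> A" for k
  proof -
    \<comment> \<open>\<open>M\<close> and \<open>p * p\<close> both divide \<open>N\<close>, so
      reduction modulo \<open>N\<close> changes neither the residue modulo \<open>M\<close> nor the
      phase.\<close>
    have kM: "k mod N mod M = k mod M"
      unfolding N_def by (simp add: mod_mod_cancel mult.assoc)
    have "(k mod N) mod (p * p) = k mod (p * p)"
      unfolding N_def by (rule mod_mod_cancel) (simp add: mult.assoc)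
    hence "(k mod N)\<^sup>2 mod (p * p) = x k"
      unfolding x_def by (metis power_mod)
    moreover have "(k mod N)\<^sup>2 mod (p * p) = p * ((k mod N)\<^sup>2 div p mod p) + (k mod N)\<^sup>2 mod p"
      by (rule mod_mult2_eq)
    ultimately have xk: "x k = p * ((k mod N)\<^sup>2 div p mod p) + (k mod N)\<^sup>2 mod p" by simp
    define t where "t = (k mod N)\<^sup>2 div p mod p"
    have t: "4 * v * w (k mod M) \<le> t" "Suc t \<le> 4 * v * w (k mod M) + v"
      using that kM by (auto simp: A_def quad_set_def t_def)
    have "x k < p * Suc t" using xk \<open>p > 0\<close> by (simp add: t_def)
    also have "\<dots> \<le> p * (4 * v * w (k mod M) + v)" by (rule mult_left_mono) (use t in auto)
    finally have up: "x k < 4 * v * p * w (k mod M) + v * p" by (simp add: algebra_simps)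
    have "p * (4 * v * w (k mod M)) \<le> p * t" by (rule mult_left_mono) (use t in auto)
    also have "\<dots> \<le> x k" using xk by (simp add: t_def)
    finally have lo: "4 * v * p * w (k mod M) \<le> x k" by (simp add: algebra_simps)
    have "x k div (4 * (v * p)) = w (k mod M)"
      by (rule div_nat_eqI) (use lo up in \<open>simp_all add: algebra_simps\<close>)
    with lo up show ?thesis by blast
  qed
  have sum_lo: "(x k + 3 * x m) div (4 * (v * p)) = w (k mod M) + 3 * w (m mod M)"
    and sum_lt: "x k + 3 * x m < p * p"
    if "k mod N \<in> A" "m mod N \<in> A" for k m
  proof -
    define q where "q = v * p"
    define u where "u = w (k mod M) + 3 * w (m mod M)"
    have lo: "u * (4 * q) \<le> x k + 3 * x m" and up: "x k + 3 * x m < u * (4 * q) + 4 * q"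
      using x[OF that(1)] x[OF that(2)] by (simp_all add: algebra_simps q_def u_def)
    show "(x k + 3 * x m) div (4 * (v * p)) = w (k mod M) + 3 * w (m mod M)"
      unfolding u_def[symmetric] q_def[symmetric]
      by (rule div_nat_eqI) (use lo up in \<open>simp_all add: algebra_simps\<close>)
    have "u \<le> 4 * W" using w[of "k mod M"] w[of "m mod M"] M by (simp add: u_def)
    hence "(u + 1) * (4 * q) \<le> (4 * W + 1) * (4 * q)" by (intro mult_right_mono) auto
    also have "\<dots> = 4 * v * (4 * W + 1) * p" by (simp add: q_def algebra_simps)
    also have "\<dots> \<le> p * p" by (rule mult_right_mono[OF p]) simp
    finally show "x k + 3 * x m < p * p" using up by (simp add: algebra_simps)
  qed
  have x_cong: "[x k = k\<^sup>2] (mod p * p)" for k by (simp add: x_def cong_def)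
  have "[x n + 3 * x (n + 2 * d) = n\<^sup>2 + 3 * (n + 2 * d)\<^sup>2] (mod p * p)"
    by (intro cong_add cong_scalar_left x_cong)
  also have "n\<^sup>2 + 3 * (n + 2 * d)\<^sup>2 = (n + 3 * d)\<^sup>2 + 3 * (n + d)\<^sup>2"
    by (simp add: power2_eq_square algebra_simps)
  also have "[\<dots> = x (n + 3 * d) + 3 * x (n + d)] (mod p * p)"
    by (intro cong_add cong_scalar_left x_cong[THEN cong_sym])
  finally have "x n + 3 * x (n + 2 * d) = x (n + 3 * d) + 3 * x (n + d)"
    using sum_lt A by (simp add: cong_def)
  thus ?thesis using sum_lo A by metis
qed

text \<open>For each \<open>n\<close> at most \<open>k\<close> of the \<open>M * k\<close>
  differences contribute, namely the multiples of \<open>M\<close>.\<close>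

lemma Lambda4_indicator_le:
  assumes "M > 0" "k > 0"
    and "\<And>n d. n < M * k \<Longrightarrow> d < M * k \<Longrightarrow> n \<in> A \<Longrightarrow> (n + d) mod (M * k) \<in> A \<Longrightarrow>
           (n + 2 * d) mod (M * k) \<in> A \<Longrightarrow> (n + 3 * d) mod (M * k) \<in> A \<Longrightarrow> M dvd d"
  shows "Lambda4 (M * k) (indicator A) \<le> 1 / real M"
proof -
  define N where "N = M * k"
  have "(\<Sum>n<N. \<Sum>d<N. indicator A n * indicator A ((n + d) mod N) * indicator A ((n + 2 * d) mod N)
      * indicator A ((n + 3 * d) mod N)) \<le> (\<Sum>n<N. \<Sum>d<N. of_bool (M dvd d) :: real)"
    using assms(3) unfolding N_def by (intro sum_mono) (auto simp: indicator_def)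
  also have "(\<Sum>d<N. of_bool (M dvd d)) = (\<Sum>a<M. \<Sum>b<k. of_bool (a = 0) :: real)"
    unfolding N_def sum_lessThan_mult
    by (intro sum.cong refl) (auto simp: dvd_add_left_iff dest: nat_dvd_not_less)
  also have "\<dots> = real k"
    using assms(1) by (simp add: of_bool_def sum.If_cases if_distrib)
  finally have "Lambda4 N (indicator A) \<le> real N * real k / real N ^ 2"
    unfolding Lambda4_def by (intro divide_right_mono) auto
  also have "\<dots> = 1 / real M"
    using assms by (simp add: N_def power2_eq_square)
  finally show ?thesis by (simp add: N_def)
qed

subsection \<open>Bounding rho4\<close>

text \<open>With \<open>L\<close> and its colouring fixed, quadratic sets for large primes test
  every admissible value against \<open>1 / M + \<epsilon>\<close>. The condition on
  \<open>\<alpha>\<close> ensures that intervals of density about \<open>\<alpha>\<close> fit at the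
  positions required by \<open>4 * R\<close> colours.\<close>

lemma rho4_le:
  fixes \<alpha> :: real and L R :: nat
  assumes L: "L \<ge> 1" and R: "R \<ge> 1" and \<alpha>: "\<alpha> > 0" "4096 * \<alpha> * real R ^ 3 \<le> 1"
    and c: "c \<in> {1..int L} \<rightarrow> {1..R}" "\<nexists>n d. symmetric_4AP L c n d"
  shows "rho4 \<alpha> \<le> 1 / real (4 * L)"
  unfolding rho4_def
proof (rule cSup_least)
  show "{\<rho>. rho4_admissible \<alpha> \<rho>} \<noteq> {}" using rho4_admissible_0 by blast
  fix \<rho> assume "\<rho> \<in> {\<rho>. rho4_admissible \<alpha> \<rho>}"
  hence adm: "rho4_admissible \<alpha> \<rho>" by simp
  define M where "M = 4 * L"
  have M: "M > 0" using L by (simp add: M_def)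
  obtain g :: "nat \<Rightarrow> nat" where g_lt: "\<And>m. m < M \<Longrightarrow> g m < 4 * R"
    and g: "\<And>n d. g (n mod M) = g ((n + 3 * d) mod M) \<Longrightarrow>
          g ((n + d) mod M) = g ((n + 2 * d) mod M) \<Longrightarrow> M dvd d"
    using cyclic_coloring[OF L R c] unfolding M_def by metis
  define W where "W = 64 * R ^ 3"
  define w where "w m = spread (g (m mod M))" for m
  have w: "w m \<le> W" for m
  proof -
    have "w m \<le> g (m mod M) ^ 3" unfolding w_def by (rule spread_le)
    also have "\<dots> \<le> (4 * R) ^ 3" using g_lt[of "m mod M"] M by (intro power_mono) auto
    finally show ?thesis by (simp add: W_def power_mult_distrib)
  qed
  have R3: "1 \<le> real R ^ 3" using R by simp
  \<comment> \<open>Source of 4096: \<open>W = 64 * R ^ 3\<close> bounds \<open>spread\<close> on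
    \<open>4 * R\<close> colours, so \<open>4 * W + 1 \<le> 512 * R ^ 3\<close>, and
    \<open>8 * 512 = 4096\<close>.\<close>
  have \<alpha>W: "8 * \<alpha> * (4 * real W + 1) \<le> 1"
  proof -
    have "8 * \<alpha> * (4 * real W + 1) \<le> 8 * \<alpha> * (512 * real R ^ 3)"
      using R3 \<alpha> by (intro mult_left_mono) (simp_all add: W_def)
    thus ?thesis using \<alpha>(2) by simp
  qed
  have \<alpha>1: "\<alpha> \<le> 1"
  proof -
    have "\<alpha> * 1 \<le> \<alpha> * (4096 * real R ^ 3)" using R3 \<alpha> by (intro mult_left_mono) auto
    thus ?thesis using \<alpha>(2) by simp
  qed
  have "\<rho> \<le> 1 / real M + \<epsilon>" if \<epsilon>: "\<epsilon> > 0" for \<epsilon>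
  proof -
    obtain \<eta> N0 where "\<eta> > 0" and *: "\<And>N A. N \<ge> N0 \<Longrightarrow> A \<subseteq> {..<N} \<Longrightarrow>
        fourier_uniform N \<eta> A \<Longrightarrow> real (card A) \<ge> (\<alpha> - \<epsilon>) * real N \<Longrightarrow>
        Lambda4 N (indicator A) \<ge> \<rho> - \<epsilon>"
      using adm \<epsilon> unfolding rho4_admissible_def by metis
    \<comment> \<open>The summands ensure in turn: \<open>N \<ge> N0\<close>, coprimality of
      \<open>2 * M\<close> and \<open>p\<close>, room for rounding \<open>\<alpha> * p\<close> up to
      \<open>v\<close>, the Fourier bound \<open>\<eta>\<close>, and a density loss of at most
      \<open>\<epsilon>\<close> from the dropped fibres.\<close>
    obtain p where p: "prime p" and "p > N0 + 2 * M + 8 * (4 * W + 1) + nat \<lceil>(2 / \<eta>)\<^sup>2\<rceil> + nat \<lceil>1 / \<epsilon>\<rceil>"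
      using bigger_prime by blast
    hence p_ge: "p \<ge> N0" "p > 2 * M" "p \<ge> 8 * (4 * W + 1)" "real p \<ge> (2 / \<eta>)\<^sup>2" "real p \<ge> 1 / \<epsilon>"
      by linarith+
    have p0: "p > 0" using p by (rule prime_gt_0_nat)
    define v where "v = nat \<lceil>\<alpha> * real p\<rceil>"
    have v: "\<alpha> * real p \<le> real v" "real v \<le> \<alpha> * real p + 1"
      using \<alpha>(1) by (simp_all add: v_def)
    have vW: "4 * v * (4 * W + 1) \<le> p"
    proof -
      have "real (4 * v * (4 * W + 1)) = real v * (4 * (4 * real W + 1))"
        by (simp add: algebra_simps)
      also have "\<dots> \<le> (\<alpha> * real p + 1) * (4 * (4 * real W + 1))"
        using v by (intro mult_right_mono) auto
      also have "\<dots> = real p / 2 * (8 * \<alpha> * (4 * real W + 1)) + 4 * (4 * real W + 1)"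
        by (simp add: algebra_simps)
      \<comment> \<open>Half of \<open>p\<close> pays for \<open>\<alpha> * p\<close>, the other
        half for the rounding error in \<open>v\<close>.\<close>
      also have "\<dots> \<le> real p / 2 * 1 + real p / 2"
      proof (intro add_mono mult_left_mono \<alpha>W)
        have "real (8 * (4 * W + 1)) \<le> real p" using p_ge(3) by (simp only: of_nat_le_iff)
        thus "4 * (4 * real W + 1) \<le> real p / 2" by simp
      qed simp
      finally have "real (4 * v * (4 * W + 1)) \<le> real p" by simp
      thus ?thesis by (simp only: of_nat_le_iff)
    qed
    define A where "A = quad_set M p v (\<lambda>m. 4 * v * w m)"
    define N where "N = M * p * p"
    have l: "4 * v * w m + v \<le> p" for m
    proof -
      have "4 * v * w m + v = v * (4 * w m + 1)" by (simp add: algebra_simps)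
      also have "\<dots> \<le> 4 * v * (4 * W + 1)" using w[of m] by (intro mult_mono) auto
      finally show ?thesis using vW by simp
    qed
    have cop: "coprime (2 * M) p"
      using prime_imp_coprime[OF p, of "2 * M"] nat_dvd_not_less[of "2 * M" p] p_ge(2) M
      by (simp add: coprime_commute)
    have "2 / sqrt (real p) \<le> \<eta>"
    proof -
      have "2 / \<eta> \<le> sqrt (real p)" using p_ge(4) by (rule real_le_rsqrt)
      thus ?thesis using \<open>\<eta> > 0\<close> p0 by (simp add: field_simps)
    qed
    hence "fourier_uniform N \<eta> A"
      using norm_fourier_quad_set_le[OF p cop M l]
      unfolding fourier_uniform_def A_def N_def by (meson order_trans)
    moreover have "(\<alpha> - \<epsilon>) * real N \<le> real (card A)"
    proof -
      have "\<alpha> \<le> \<epsilon> * real p"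
        using p_ge(5) \<epsilon> \<alpha>1 by (simp add: field_simps)
      hence "\<alpha> * (real M * real p) \<le> \<epsilon> * real p * (real M * real p)"
        by (intro mult_right_mono) auto
      hence "(\<alpha> - \<epsilon>) * real N \<le> (real p - 1) * real M * (\<alpha> * real p)"
        by (simp add: N_def algebra_simps)
      also have "\<dots> \<le> (real p - 1) * real M * real v"
        using v p0 by (intro mult_left_mono) auto
      also have "\<dots> = real ((p - 1) * M * v)" using p0 by (simp add: of_nat_diff)
      also have "\<dots> \<le> real (card A)"
        using card_quad_set[OF p cop l] unfolding A_def of_nat_le_iff .
      finally show ?thesis .
    qed
    moreover have "p \<le> N" unfolding N_def using M p0 by simp
    hence "N0 \<le> N" using p_ge(1) by simp
    moreover have "A \<subseteq> {..<N}" by (auto simp: A_def N_def quad_set_def)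
    ultimately have "\<rho> - \<epsilon> \<le> Lambda4 N (indicator A)" using * by blast
    also have "Lambda4 N (indicator A :: nat \<Rightarrow> real) \<le> 1 / real M"
      unfolding N_def mult.assoc
    proof (rule Lambda4_indicator_le)
      show "p * p > 0" using p0 by simp
      fix n d assume n: "n < M * (p * p)" and A: "n \<in> A" "(n + d) mod (M * (p * p)) \<in> A"
        "(n + 2 * d) mod (M * (p * p)) \<in> A" "(n + 3 * d) mod (M * (p * p)) \<in> A"
      have mem: "n mod N \<in> A" "(n + d) mod N \<in> A" "(n + 2 * d) mod N \<in> A" "(n + 3 * d) mod N \<in> A"
        using n A by (simp_all add: N_def mult.assoc)
      have "w (n mod M) + 3 * w ((n + 2 * d) mod M) = w ((n + 3 * d) mod M) + 3 * w ((n + d) mod M)"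
        using mem unfolding A_def N_def by (rule quad_set_4AP[OF M w vW])
      hence "g (n mod M) = g ((n + 3 * d) mod M) \<and> g ((n + 2 * d) mod M) = g ((n + d) mod M)"
        unfolding w_def mod_mod_trivial by (rule spread_add_eq)
      thus "M dvd d" using g[of n d] by simp
    qed (rule M)
    finally show ?thesis by simp
  qed
  hence "\<rho> \<le> 1 / real M" by (rule field_le_epsilon)
  thus "\<rho> \<le> 1 / real (4 * L)" by (simp add: M_def)
qed

section \<open>Choice of parameters\<close>

theorem theorem1p7:
  fixes r :: "nat \<Rightarrow> nat"
  assumes "\<forall>N\<ge>1. r N \<ge> 1"
    and "(\<lambda>N. ln (real (r N)) / ln (real N)) \<longlonglongrightarrow> 0"
    and "\<forall>N\<ge>1. \<exists>c. c \<in> {1..int N} \<rightarrow> {1..r N} \<and> (\<nexists>n d. symmetric_4AP N c n d)"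
  shows "\<forall>C>0. \<forall>\<^sub>F \<alpha> in at_right (0 :: real). rho4 \<alpha> < \<alpha> powr C"
proof (intro allI impI)
  fix C :: real assume C: "C > 0"
  \<comment> \<open>For \<open>L\<close> at most \<open>\<alpha> powr (- (C + 1))\<close> this
    exponent gives \<open>r L \<le> \<alpha> powr (- 1 / 6)\<close>. Then
    \<open>4096 * \<alpha> * r L ^ 3\<close> is at most \<open>4096 * \<alpha> powr (1 / 2)\<close>,
    which is below 1 once \<open>\<alpha> < 1 / 4096\<^sup>2\<close>.\<close>
  define \<delta> where "\<delta> = 1 / (6 * (C + 1))"
  have \<delta>: "\<delta> > 0" using C by (simp add: \<delta>_def)
  obtain K where K: "\<And>N. N \<ge> K \<Longrightarrow> ln (real (r N)) / ln (real N) < \<delta>"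
    using order_tendstoD(2)[OF assms(2) \<delta>] unfolding eventually_sequentially by blast
  have "filterlim (\<lambda>\<alpha>::real. \<alpha> powr (- C)) at_top (at_right 0)"
    using C by real_asymp
  hence "\<forall>\<^sub>F \<alpha> in at_right (0 :: real). real (K + 2) \<le> \<alpha> powr (- C)"
    unfolding filterlim_at_top by blast
  moreover have "\<forall>\<^sub>F \<alpha> in at_right (0 :: real). \<alpha> \<in> {0<..<1 / 4096\<^sup>2}"
    by (rule eventually_at_right_real) simp
  ultimately show "\<forall>\<^sub>F \<alpha> in at_right (0 :: real). rho4 \<alpha> < \<alpha> powr C"
  proof eventually_elim
    fix \<alpha> :: real
    assume big: "real (K + 2) \<le> \<alpha> powr (- C)" and \<alpha>: "\<alpha> \<in> {0<..<1 / 4096\<^sup>2}"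
    \<comment> \<open>This size gives \<open>1 / L \<le> \<alpha> powr C\<close>; strictness comes
      from the factor 4 in \<open>rho4_le\<close>.\<close>
    define L where "L = nat \<lceil>\<alpha> powr (- C)\<rceil>"
    have L: "\<alpha> powr (- C) \<le> real L" "real L \<le> \<alpha> powr (- C) + 1"
      unfolding L_def by simp_all
    \<comment> \<open>\<open>K\<close> makes the bound on \<open>r L\<close> available, and 2 makes
      \<open>ln L\<close> positive, so that the quotient can be cleared.\<close>
    have L_ge: "L \<ge> K" "L \<ge> 2" using big L by linarith+
    have r1: "r L \<ge> 1" using assms(1) L_ge by simp
    have ln\<alpha>: "ln \<alpha> \<le> - 2 * ln 4096"
    proof -
      have "ln \<alpha> \<le> ln (1 / 4096\<^sup>2)" using \<alpha> by (intro ln_mono) auto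
      also have "\<dots> = - 2 * ln 4096" by (simp only: ln_div ln_realpow) simp
      finally show ?thesis .
    qed
    have "ln (real L) \<le> (C + 1) * - ln \<alpha>"
    proof -
      \<comment> \<open>Rounding up costs at most a factor 2, which
        \<open>\<alpha> \<le> 1 / 2\<close> absorbs into one more power of
        \<open>1 / \<alpha>\<close>.\<close>
      have "real L \<le> 2 * \<alpha> powr (- C)" using L big by linarith
      also have "\<dots> \<le> (1 / \<alpha>) * \<alpha> powr (- C)"
        using \<alpha> by (intro mult_right_mono) (auto simp: field_simps)
      finally have "ln (real L) \<le> ln ((1 / \<alpha>) * \<alpha> powr (- C))"
        using L_ge by (intro ln_mono) auto
      also have "\<dots> = (C + 1) * - ln \<alpha>"
        using \<alpha> by (simp add: ln_mult ln_div ln_powr algebra_simps)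
      finally show ?thesis .
    qed
    moreover have "ln (real (r L)) \<le> \<delta> * ln (real L)"
      using K[OF L_ge(1)] L_ge(2) by (simp add: divide_less_eq)
    ultimately have "ln (real (r L)) \<le> \<delta> * ((C + 1) * - ln \<alpha>)"
      using \<delta> by (meson mult_left_mono order_trans less_imp_le)
    also have "\<delta> * ((C + 1) * - ln \<alpha>) = - ln \<alpha> / 6"
      using C by (simp add: \<delta>_def divide_simps)
    finally have lnr: "ln (real (r L)) \<le> - ln \<alpha> / 6" .
    have "ln (4096 * \<alpha> * real (r L) ^ 3) = ln 4096 + ln \<alpha> + 3 * ln (real (r L))"
      using \<alpha> r1 by (simp add: ln_mult ln_realpow)
    also have "\<dots> \<le> 0" using lnr ln\<alpha> by linarith
    finally have "4096 * \<alpha> * real (r L) ^ 3 \<le> 1"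
      using \<alpha> r1 by (subst (asm) ln_le_zero_iff) auto
    moreover obtain c where "c \<in> {1..int L} \<rightarrow> {1..r L}" "\<nexists>n d. symmetric_4AP L c n d"
      using assms(3) L_ge by (meson one_le_numeral order_trans)
    ultimately have "rho4 \<alpha> \<le> 1 / real (4 * L)"
      using \<alpha> L_ge r1 by (intro rho4_le[where c = c and R = "r L"]) auto
    also have "\<dots> < 1 / real L" using L_ge by (simp add: field_simps)
    also have "\<dots> \<le> 1 / \<alpha> powr (- C)"
      using L(1) L_ge \<alpha> by (intro divide_left_mono mult_pos_pos) auto
    also have "\<dots> = \<alpha> powr C" by (simp add: powr_minus divide_inverse)
    finally show "rho4 \<alpha> < \<alpha> powr C" .
  qed
qed

end
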